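(* Let $r,n\in\mathbb{N}=\{1,2,3,\ldots\}$ and let $x$ be real with $|x|<1$. Then the $r$-th moment of the Meyer-König and Zeller operator $M_n$ satisfies $$ (M_n e_r)(x)=1+\frac{1}{n!}(1-x)^{n+1}\sum_{s=1}^{r}(-1)^s\binom{r}{s}n^s\,\mathrm{Li}_s^{(n)}(x), $$ where $\mathrm{Li}_s^{(n)}$ denotes the $n$-th derivative of the polylogarithm $\mathrm{Li}_s$.
   Context: For $n\in\mathbb{N}=\{1,2,3,\ldots\}$, the Meyer-König and Zeller (MKZ) operator $M_n$ is defined by $$ (M_n f)(x)=(1-x)^{n+1}\sum_{\nu=0}^{\infty}\binom{\nu+n}{\nu}f\left(\frac{\nu}{\nu+n}\right)x^{\nu}, $$ for those real $x$ with $|x|<1$ (for the monomials $f=e_r$ the series converges for all such $x$). For $r\in\mathbb{N}$, $e_r$ denotes the monomial $e_r(t)=t^r$; thus the $r$-th moment is $$(M_n e_r)(x)=(1-x)^{n+1}\sum_{\nu=0}^{\infty}\binom{\nu+n}{\nu}\left(\frac{\nu}{\nu+n}\right)^{r}x^{\nu}.$$ For $s\in\mathbb{N}$, the polylogarithm is $\mathrm{Li}_s(x)=\sum_{\nu=1}^{\infty}\frac{x^{\nu}}{\nu^{s}}$ for $|x|<1$. *)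

theory Defs
  imports "HOL-Analysis.Analysis"
begin

text \<open>The series are only meant for \<open>\<bar>x\<bar> < 1\<close>; elsewhere \<^const>\<open>suminf\<close> may be an unspecified value.\<close>

definition MKZ :: "nat \<Rightarrow> (real \<Rightarrow> real) \<Rightarrow> real \<Rightarrow> real" where
  "MKZ n f x = (1 - x) ^ (n + 1) *
     (\<Sum>\<nu>. real ((\<nu> + n) choose \<nu>) * f (real \<nu> / real (\<nu> + n)) * x ^ \<nu>)"

definition monomial :: "nat \<Rightarrow> real \<Rightarrow> real" where
  "monomial r = (\<lambda>t. t ^ r)"

text \<open>The summation index is shifted so that the series starts with the term \<open>x ^ 1 / 1 ^ s\<close>.\<close>

definition polylog :: "nat \<Rightarrow> real \<Rightarrow> real" where
  "polylog s x = (\<Sum>\<nu>. x ^ Suc \<nu> / real (Suc \<nu>) ^ s)"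

end

theory Submission
  imports Defs
begin

text \<open>
  Write \<open>\<nu> / (\<nu> + n) = 1 - n / (\<nu> + n)\<close> and expand its \<open>r\<close>-th power binomially. The term \<open>s = 0\<close>
  contributes the negative binomial series of \<open>1 / (1 - x) ^ (n + 1)\<close>; for \<open>s \<ge> 1\<close> the series
  \<open>\<Sum>\<nu>. ((\<nu> + n) choose \<nu>) x ^ \<nu> / (\<nu> + n) ^ s\<close> is \<open>1 / n!\<close> times the \<open>n\<close>-fold termwise
  derivative of \<open>Li\<^sub>s\<close>.
\<close>

text \<open>Termwise differentiation, iterated by induction on \<open>n\<close>. The point
  \<open>x\<close> stays arbitrary because each differentiation needs convergence on the whole open
  ball, not only at \<open>x\<close>.\<close>

lemma higher_deriv_power_series_sums:
  fixes c :: "nat \<Rightarrow> 'a::{real_normed_field,banach}"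
  assumes "\<And>z. norm z < K \<Longrightarrow> (\<lambda>m. c m * z ^ m) sums f z" and "norm x < K"
  shows "(\<lambda>m. (diffs ^^ n) c m * x ^ m) sums (deriv ^^ n) f x"
  using assms(2)
proof (induction n arbitrary: x)
  case 0
  then show ?case using assms(1) by simp
next
  case (Suc n)
  let ?g = "\<lambda>z. \<Sum>m. (diffs ^^ n) c m * z ^ m"
  have "(?g has_field_derivative (\<Sum>m. diffs ((diffs ^^ n) c) m * x ^ m)) (at x)"
    by (rule termdiffs_strong'[OF _ Suc.prems]) (rule sums_summable[OF Suc.IH])
  \<comment> \<open>Equality on an open neighbourhood of \<open>x\<close> is what allows the
    derivative of \<open>?g\<close> to be transferred to \<open>(deriv ^^ n) f\<close>.\<close>
  moreover have "?g z = (deriv ^^ n) f z" if "z \<in> ball 0 K" for z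
    using that Suc.IH[of z] by (simp add: sums_iff)
  ultimately have "((deriv ^^ n) f has_field_derivative
      (\<Sum>m. diffs ((diffs ^^ n) c) m * x ^ m)) (at x)"
    using has_field_derivative_transform_within_open[of ?g _ x "ball 0 K" "(deriv ^^ n) f"] Suc.prems
    by simp
  then have "(deriv ^^ Suc n) f x = (\<Sum>m. diffs ((diffs ^^ n) c) m * x ^ m)"
    by (simp add: DERIV_imp_deriv)
  moreover have "summable (\<lambda>m. diffs ((diffs ^^ n) c) m * x ^ m)"
    by (rule termdiff_converges[OF Suc.prems]) (rule sums_summable[OF Suc.IH])
  ultimately show ?case by (simp add: summable_sums)
qed

text \<open>Each \<open>diffs\<close> shifts the index and multiplies by it, so \<open>n\<close> of
  them give the product (m+1)...(m+n) = (m+n)!/m!, written here with the binomial weight of the MKZ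
  operator.\<close>

lemma funpow_diffs:
  fixes c :: "nat \<Rightarrow> 'a::field_char_0"
  shows "(diffs ^^ n) c m = fact n * of_nat ((m + n) choose m) * c (m + n)"
proof (induction n arbitrary: m)
  case 0
  then show ?case by simp
next
  case (Suc n)
  have "Suc m * (Suc (m + n) choose Suc m) = Suc n * (Suc (m + n) choose m)"
    using Suc_times_binomial_add[of m n] by (simp add: add.commute)
  then have "of_nat (Suc m) * of_nat (Suc (m + n) choose Suc m) =
      (of_nat (Suc n) * of_nat (Suc (m + n) choose m) :: 'a)"
    by (metis of_nat_mult)
  moreover have "(diffs ^^ Suc n) c m =
      fact n * (of_nat (Suc m) * of_nat (Suc (m + n) choose Suc m)) * c (Suc (m + n))"
    by (simp only: funpow.simps o_apply diffs_def[of "(diffs ^^ n) c"] Suc.IH add_Suc mult_ac)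
  ultimately show ?case
    by (simp only: fact_Suc add_Suc_right mult_ac)
qed

lemma sums_polylog:
  fixes x :: real
  assumes "\<bar>x\<bar> < 1" and "s \<ge> 1"
  shows "(\<lambda>m. 1 / real m ^ s * x ^ m) sums polylog s x"
proof -
  have "summable (\<lambda>k. x ^ Suc k / real (Suc k) ^ s)"
  proof (rule summable_comparison_test')
    show "summable (\<lambda>k. \<bar>x\<bar> ^ k)"
      using assms(1) by (simp add: summable_geometric)
    show "norm (x ^ Suc k / real (Suc k) ^ s) \<le> \<bar>x\<bar> ^ k" for k
    proof -
      have "\<bar>x\<bar> ^ Suc k / real (Suc k) ^ s \<le> \<bar>x\<bar> ^ Suc k / 1"
        by (intro divide_left_mono) (auto simp del: of_nat_Suc)
      also have "\<dots> \<le> \<bar>x\<bar> ^ k"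
        using assms(1) by (simp add: mult_left_le_one_le)
      finally show ?thesis
        by (simp add: power_abs abs_mult)
    qed
  qed
  then have "(\<lambda>k. 1 / real (Suc k) ^ s * x ^ Suc k) sums polylog s x"
    by (simp add: polylog_def summable_sums)
  \<comment> \<open>Undoing the index shift adds a term at m = 0. It vanishes:
    \<open>s \<ge> 1\<close> gives 0 ^ s = 0, and division by zero yields 0.\<close>
  then show ?thesis
    using assms(2) sums_Suc_iff[of "\<lambda>m. 1 / real m ^ s * x ^ m"]
    by (simp add: power_0_left)
qed

lemma higher_deriv_polylog_sums:
  fixes x :: real
  assumes "\<bar>x\<bar> < 1" and "s \<ge> 1"
  shows "(\<lambda>\<nu>. real ((\<nu> + n) choose \<nu>) * (1 / real (\<nu> + n) ^ s) * x ^ \<nu>) sums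
    ((deriv ^^ n) (polylog s) x / fact n)"
proof -
  have "(\<lambda>\<nu>. (diffs ^^ n) (\<lambda>m. 1 / real m ^ s) \<nu> * x ^ \<nu>) sums (deriv ^^ n) (polylog s) x"
    using higher_deriv_power_series_sums[of 1 "\<lambda>m. 1 / real m ^ s" "polylog s" x n]
      sums_polylog assms by simp
  then show ?thesis
    by (auto dest: sums_divide[where c = "fact n"] simp: funpow_diffs)
qed

text \<open>Newton's binomial series at \<open>- x\<close> with exponent -(n+1); upper negation
  turns its generalized coefficients into ordinary ones, and the signs cancel.\<close>

lemma negative_binomial_sums:
  fixes x :: real
  assumes "\<bar>x\<bar> < 1"
  shows "(\<lambda>\<nu>. real ((\<nu> + n) choose \<nu>) * x ^ \<nu>) sums (1 / (1 - x) ^ (n + 1))"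
proof -
  have "(- real (n + 1) gchoose \<nu>) * (- x) ^ \<nu> = real ((\<nu> + n) choose \<nu>) * x ^ \<nu>" for \<nu>
  proof -
    have "(- real (n + 1) gchoose \<nu>) = (- 1) ^ \<nu> * (real (\<nu> + n) gchoose \<nu>)"
      using gbinomial_minus[of "real (n + 1)" \<nu>] by (simp add: add.commute)
    moreover have "(- 1) ^ \<nu> * (- x) ^ \<nu> = x ^ \<nu>"
      by (simp flip: power_mult_distrib)
    ultimately show ?thesis
      by (simp add: binomial_gbinomial mult.commute mult.left_commute)
  qed
  \<comment> \<open>Passing from \<open>powr\<close> to an integer power relies on 1 - x >
    0.\<close>
  moreover have "(1 - x) powr - real (n + 1) = 1 / (1 - x) ^ (n + 1)"
    using assms powr_realpow[of "1 - x" "n + 1"] by (simp only: powr_minus_divide)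
  ultimately show ?thesis
    using gen_binomial_real[of "- x" "- real (n + 1)"] assms by simp
qed

theorem theorem1:
  fixes r n :: nat and x :: real
  assumes "r \<ge> 1" and "n \<ge> 1" and "\<bar>x\<bar> < 1"
  shows "MKZ n (monomial r) x =
    1 + 1 / fact n * (1 - x) ^ (n + 1) *
      (\<Sum>s=1..r. (-1) ^ s * real (r choose s) * real n ^ s * (deriv ^^ n) (polylog s) x)"
proof -
  let ?b = "\<lambda>\<nu>. real ((\<nu> + n) choose \<nu>)"
  let ?a = "\<lambda>s. (-1) ^ s * real (r choose s) * real n ^ s"
  let ?D = "\<lambda>s. (deriv ^^ n) (polylog s) x"
  have expand: "?b \<nu> * monomial r (real \<nu> / real (\<nu> + n)) * x ^ \<nu> =
      ?b \<nu> * x ^ \<nu> + (\<Sum>s=1..r. ?a s * (?b \<nu> * (1 / real (\<nu> + n) ^ s) * x ^ \<nu>))" for \<nu>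
  proof -
    \<comment> \<open>\<open>n \<ge> 1\<close> keeps the denominator nonzero even at \<nu> =
      0.\<close>
    have "real \<nu> / real (\<nu> + n) = - (real n / real (\<nu> + n)) + 1"
      using assms(2) by (simp add: field_simps)
    then have "monomial r (real \<nu> / real (\<nu> + n)) =
        (\<Sum>s\<le>r. real (r choose s) * (- (real n / real (\<nu> + n))) ^ s)"
      by (simp only: monomial_def binomial_ring) simp
    also have "\<dots> = (\<Sum>s\<le>r. ?a s * (1 / real (\<nu> + n) ^ s))"
      by (intro sum.cong refl, subst power_minus) (simp add: power_divide)
    also have "\<dots> = 1 + (\<Sum>s=1..r. ?a s * (1 / real (\<nu> + n) ^ s))"
      by (simp add: sum.atMost_shift sum.atLeast1_atMost_eq)
    finally show ?thesis
      by (simp add: algebra_simps sum_distrib_left sum_distrib_right)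
  qed
  have "(\<lambda>\<nu>. ?b \<nu> * monomial r (real \<nu> / real (\<nu> + n)) * x ^ \<nu>) sums
      (1 / (1 - x) ^ (n + 1) + (\<Sum>s=1..r. ?a s * (?D s / fact n)))"
    \<comment> \<open>The sum over \<open>s\<close> is finite, so it may be exchanged with the
      series once each summand is known to converge; \<open>s \<ge> 1\<close> holds throughout its
      range.\<close>
    unfolding expand
    by (intro sums_add sums_sum sums_mult negative_binomial_sums higher_deriv_polylog_sums assms) simp
  then have "MKZ n (monomial r) x =
      (1 - x) ^ (n + 1) * (1 / (1 - x) ^ (n + 1) + (\<Sum>s=1..r. ?a s * (?D s / fact n)))"
    by (simp only: MKZ_def sums_iff)
  also have "\<dots> = 1 + (1 - x) ^ (n + 1) * (\<Sum>s=1..r. ?a s * (?D s / fact n))"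
    using assms(3) by (simp add: distrib_left del: power_Suc)
  also have "(\<Sum>s=1..r. ?a s * (?D s / fact n)) = 1 / fact n * (\<Sum>s=1..r. ?a s * ?D s)"
    by (simp add: sum_distrib_left)
  finally show ?thesis by (simp only: mult_ac)
qed

end
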